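(* For every commutative ring $R$ with $1$ and every positive integer $n$, every semiprime submodule of $R^n$ is weakly semiprime. The converse is false in general: there exist a commutative ring $R$ with $1$, a positive integer $n$ and a submodule of $R^n$ that is weakly semiprime but not semiprime.
   Context: A submodule $N$ of $R^n$ is semiprime if for every $\mathbf{f}=(f_1,\ldots,f_n)\in R^n$ such that $f_i\mathbf{f}\in N$ for $i=1,\ldots,n$ we have $\mathbf{f}\in N$. A submodule $N$ of an $R$-module $M$ is weakly semiprime if for every $r\in R$ and every $\mathbf{m}\in M$ such that $r^2\mathbf{m}\in N$ we have $r\mathbf{m}\in N$. *)

theory Defs
  imports
    "HOL-Computational_Algebra.Polynomial"
    "HOL-Algebra.Module"
begin

text \<open>
  \<^verbatim>\<open>free_mod R n\<close> is \<open>R\<^sup>n\<close>: families indexed by \<open>{1..n}\<close> with components in \<open>R\<close>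
  (extensional, so that equality of vectors is equality of functions), with componentwise operations.
  The \<^verbatim>\<open>module\<close> record extends the ring record, so a multiplication and a unit
  have to be supplied; they play no role for modules and are also taken componentwise.
\<close>

definition free_mod :: "('a, 'm) ring_scheme \<Rightarrow> nat \<Rightarrow> ('a, nat \<Rightarrow> 'a) module"
  where "free_mod R n =
    \<lparr> carrier = {1..n} \<rightarrow>\<^sub>E carrier R,
      monoid.mult = (\<lambda>f g. \<lambda>i\<in>{1..n}. f i \<otimes>\<^bsub>R\<^esub> g i),
      monoid.one = (\<lambda>i\<in>{1..n}. \<one>\<^bsub>R\<^esub>),
      ring.zero = (\<lambda>i\<in>{1..n}. \<zero>\<^bsub>R\<^esub>),
      ring.add = (\<lambda>f g. \<lambda>i\<in>{1..n}. f i \<oplus>\<^bsub>R\<^esub> g i),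
      module.smult = (\<lambda>r f. \<lambda>i\<in>{1..n}. r \<otimes>\<^bsub>R\<^esub> f i) \<rparr>"

definition semiprime_submodule :: "('a, 'm) ring_scheme \<Rightarrow> nat \<Rightarrow> (nat \<Rightarrow> 'a) set \<Rightarrow> bool"
  where "semiprime_submodule R n N \<longleftrightarrow>
    submodule N R (free_mod R n) \<and>
    (\<forall>f \<in> carrier (free_mod R n).
      (\<forall>i\<in>{1..n}. f i \<odot>\<^bsub>free_mod R n\<^esub> f \<in> N) \<longrightarrow> f \<in> N)"

definition weakly_semiprime_submodule ::
    "('a, 'm) ring_scheme \<Rightarrow> ('a, 'b, 'k) module_scheme \<Rightarrow> 'b set \<Rightarrow> bool"
  where "weakly_semiprime_submodule R M N \<longleftrightarrow>
    submodule N R M \<and>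
    (\<forall>r \<in> carrier R. \<forall>m \<in> carrier M.
      (r [^]\<^bsub>R\<^esub> (2::nat)) \<odot>\<^bsub>M\<^esub> m \<in> N \<longrightarrow> r \<odot>\<^bsub>M\<^esub> m \<in> N)"

lemma free_mod_module:
  assumes "cring R"
  shows "module R (free_mod R n)"
proof -
  interpret cring R by fact
  have ext: "restrict u A = restrict v A"
    if "\<And>i. i \<in> A \<Longrightarrow> u i = v i" for u v :: "nat \<Rightarrow> 'a" and A
    using that by (auto simp: restrict_def fun_eq_iff)
  have mem: "f i \<in> carrier R" if "f \<in> {Suc 0..n} \<rightarrow>\<^sub>E carrier R" "Suc 0 \<le> i" "i \<le> n" for f i
    using that by (auto simp: PiE_def Pi_def)
  show ?thesis
  proof (rule moduleI)
    show "abelian_group (free_mod R n)"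
    proof (rule abelian_groupI)
      fix x assume "x \<in> carrier (free_mod R n)"
      then show "\<exists>y\<in>carrier (free_mod R n). y \<oplus>\<^bsub>free_mod R n\<^esub> x = \<zero>\<^bsub>free_mod R n\<^esub>"
        by (intro bexI[of _ "\<lambda>i\<in>{1..n}. \<ominus>\<^bsub>R\<^esub> x i"])
           (auto simp: free_mod_def mem l_neg intro!: ext)
    next
      fix x assume x: "x \<in> carrier (free_mod R n)"
      show "\<zero>\<^bsub>free_mod R n\<^esub> \<oplus>\<^bsub>free_mod R n\<^esub> x = x"
        using x by (intro PiE_ext[of _ "{1..n}" "\<lambda>_. carrier R"]) (auto simp: free_mod_def mem)
    qed (auto simp: free_mod_def mem a_ac intro!: ext)
  next
    fix x assume x: "x \<in> carrier (free_mod R n)"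
    show "\<one>\<^bsub>R\<^esub> \<odot>\<^bsub>free_mod R n\<^esub> x = x"
      using x by (intro PiE_ext[of _ "{1..n}" "\<lambda>_. carrier R"]) (auto simp: free_mod_def mem)
  qed (auto simp: free_mod_def mem l_distr r_distr m_assoc assms intro!: ext)
qed

end

theory Submission
  imports Defs
begin

text \<open>
  Suppose \<open>r\<^sup>2 m \<in> N\<close> and put \<open>f = r m\<close>. Then \<open>f\<^sub>i f = m\<^sub>i (r\<^sup>2 m)\<close> lies in \<open>N\<close> for every \<open>i\<close>,
  so a semiprime \<open>N\<close> contains \<open>f\<close>; this is the positive half.

  For the converse take \<open>R = \<int>[x]\<close>, the maximal ideal \<open>I = (2, x)\<close> and the vector
  \<open>f = (2, x)\<close> whose entries generate \<open>I\<close>, and let \<open>N = I f\<close>. By construction \<open>f\<^sub>i f \<in> N\<close> for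
  both \<open>i\<close>, while \<open>f \<notin> N\<close> because \<open>1 \<notin> I\<close>. That \<open>N\<close> is nevertheless weakly semiprime has two
  causes. As \<open>2\<close> and \<open>x\<close> are coprime, \<open>R\<^sup>2 / R f\<close> is torsion-free, so \<open>r\<^sup>2 m \<in> N\<close> with
  \<open>r \<noteq> 0\<close> forces \<open>m = s f\<close>; and as \<open>I\<close> is prime, \<open>r\<^sup>2 s \<in> I\<close> forces \<open>r s \<in> I\<close>, that is,
  \<open>r m \<in> N\<close>. The example works because \<open>I\<close> is not principal: over a Bezout domain one could
  write \<open>f = d g\<close> with \<open>d\<close> in the ideal of the entries, and apply weak semiprimeness to \<open>d\<^sup>2 g\<close>.
\<close>

lemma semiprime_submodule_imp_weakly_semiprime:
  fixes R (structure)
  assumes "cring R" and sp: "semiprime_submodule R n N"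
  shows "weakly_semiprime_submodule R (free_mod R n) N"
  unfolding weakly_semiprime_submodule_def
proof (intro conjI ballI impI)
  let ?M = "free_mod R n"
  interpret M: module R ?M using free_mod_module[OF \<open>cring R\<close>] .
  show sub: "submodule N R ?M" using sp by (simp add: semiprime_submodule_def)
  fix r m
  assume r: "r \<in> carrier R" and m: "m \<in> carrier ?M"
    and r2m: "(r [^] (2::nat)) \<odot>\<^bsub>?M\<^esub> m \<in> N"
  have "(r \<odot>\<^bsub>?M\<^esub> m) i \<odot>\<^bsub>?M\<^esub> (r \<odot>\<^bsub>?M\<^esub> m) \<in> N" if i: "i \<in> {1..n}" for i
  proof -
    have mi: "m i \<in> carrier R" using m i by (auto simp: free_mod_def)
    have "(r \<odot>\<^bsub>?M\<^esub> m) i = r \<otimes> m i" using i by (simp add: free_mod_def)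
    then have "(r \<odot>\<^bsub>?M\<^esub> m) i \<odot>\<^bsub>?M\<^esub> (r \<odot>\<^bsub>?M\<^esub> m) = ((r \<otimes> m i) \<otimes> r) \<odot>\<^bsub>?M\<^esub> m"
      using r m mi by (simp add: M.smult_assoc1)
    also have "(r \<otimes> m i) \<otimes> r = m i \<otimes> (r [^] (2::nat))"
      using r mi by (simp add: numeral_2_eq_2 M.m_ac)
    also have "\<dots> \<odot>\<^bsub>?M\<^esub> m = m i \<odot>\<^bsub>?M\<^esub> ((r [^] (2::nat)) \<odot>\<^bsub>?M\<^esub> m)"
      using r m mi by (simp add: M.smult_assoc1)
    also have "\<dots> \<in> N" using submodule.smult_closed[OF sub mi r2m] .
    finally show ?thesis .
  qed
  then show "r \<odot>\<^bsub>?M\<^esub> m \<in> N"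
    using sp r m by (auto simp: semiprime_submodule_def)
qed

definition int_poly_ring :: "int poly ring"
  where "int_poly_ring = \<lparr> carrier = UNIV, monoid.mult = (*), one = 1, zero = 0, add = (+) \<rparr>"

lemma int_poly_ring_simps [simp]:
  "carrier int_poly_ring = UNIV"
  "p \<otimes>\<^bsub>int_poly_ring\<^esub> q = p * q"
  "\<one>\<^bsub>int_poly_ring\<^esub> = 1"
  "\<zero>\<^bsub>int_poly_ring\<^esub> = 0"
  "p \<oplus>\<^bsub>int_poly_ring\<^esub> q = p + q"
  by (simp_all add: int_poly_ring_def)

lemma cring_int_poly_ring: "cring int_poly_ring"
proof (rule cringI)
  show "abelian_group int_poly_ring"
  proof (rule abelian_groupI)
    show "\<exists>q\<in>carrier int_poly_ring. q \<oplus>\<^bsub>int_poly_ring\<^esub> p = \<zero>\<^bsub>int_poly_ring\<^esub>" for p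
      by (rule bexI[of _ "- p"]) simp_all
  qed (simp_all add: ac_simps)
  show "comm_monoid int_poly_ring"
    by (rule comm_monoidI) (simp_all add: ac_simps)
qed (simp add: algebra_simps)

lemma int_poly_ring_square [simp]: "p [^]\<^bsub>int_poly_ring\<^esub> (2::nat) = p * p"
  by (simp add: numeral_2_eq_2)

definition multiple_of_2_x :: "int poly \<Rightarrow> nat \<Rightarrow> int poly"
  where "multiple_of_2_x s = (\<lambda>i\<in>{1..2}. if i = 1 then 2 * s else [:0, 1:] * s)"

text \<open>
  This is \<open>I f\<close> for the ideal \<open>I = (2, x)\<close> and the vector \<open>f = (2, x)\<close>, because \<open>I\<close> consists of
  the polynomials with even constant term.
\<close>

definition ideal_multiples_of_2_x :: "(nat \<Rightarrow> int poly) set"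
  where "ideal_multiples_of_2_x = multiple_of_2_x ` {s. even (coeff s 0)}"

lemma multiple_of_2_x_eq_iff:
  assumes "v \<in> carrier (free_mod int_poly_ring 2)"
  shows "v = multiple_of_2_x s \<longleftrightarrow> v 1 = 2 * s \<and> v 2 = [:0, 1:] * s"
proof
  assume R: "v 1 = 2 * s \<and> v 2 = [:0, 1:] * s"
  have "v i = multiple_of_2_x s i" for i
  proof (cases "i \<in> {1..2}")
    case True
    then have "i = 1 \<or> i = 2" by auto
    with R show ?thesis by (auto simp: multiple_of_2_x_def)
  next
    case False
    with assms show ?thesis
      by (auto simp: multiple_of_2_x_def free_mod_def PiE_def extensional_def)
  qed
  then show "v = multiple_of_2_x s" by blast
qed (simp add: multiple_of_2_x_def)

lemma multiple_of_2_x_closed: "multiple_of_2_x s \<in> carrier (free_mod int_poly_ring 2)"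
  by (auto simp: multiple_of_2_x_def free_mod_def)

lemma multiple_of_2_x_add:
  "multiple_of_2_x s \<oplus>\<^bsub>free_mod int_poly_ring 2\<^esub> multiple_of_2_x t = multiple_of_2_x (s + t)"
  by (auto simp: multiple_of_2_x_def free_mod_def fun_eq_iff algebra_simps)

lemma multiple_of_2_x_smult:
  "r \<odot>\<^bsub>free_mod int_poly_ring 2\<^esub> multiple_of_2_x s = multiple_of_2_x (r * s)"
  by (auto simp: multiple_of_2_x_def free_mod_def fun_eq_iff algebra_simps)

lemma multiple_of_2_x_eqD: "multiple_of_2_x s = multiple_of_2_x t \<Longrightarrow> s = t"
  by (drule fun_cong[of _ _ 1]) (simp add: multiple_of_2_x_def)

lemma multiple_of_2_x_mem_iff:
  "multiple_of_2_x s \<in> ideal_multiples_of_2_x \<longleftrightarrow> even (coeff s 0)"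
  unfolding ideal_multiples_of_2_x_def by (auto dest: multiple_of_2_x_eqD)

lemma submodule_ideal_multiples_of_2_x:
  "submodule ideal_multiples_of_2_x int_poly_ring (free_mod int_poly_ring 2)"
proof -
  let ?M = "free_mod int_poly_ring 2" and ?N = ideal_multiples_of_2_x
  interpret M: module int_poly_ring ?M using free_mod_module[OF cring_int_poly_ring] .
  have smult: "r \<odot>\<^bsub>?M\<^esub> v \<in> ?N" if "v \<in> ?N" for r v
    using that unfolding ideal_multiples_of_2_x_def
    by (auto simp: multiple_of_2_x_smult coeff_mult_0)
  show ?thesis
  proof (rule M.submoduleI)
    show "?N \<subseteq> carrier ?M"
      by (auto simp: ideal_multiples_of_2_x_def multiple_of_2_x_closed)
    show "\<zero>\<^bsub>?M\<^esub> \<in> ?N"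
      using smult[of "multiple_of_2_x 0" 0] M.smult_l_null multiple_of_2_x_closed
      by (simp add: multiple_of_2_x_mem_iff)
    show "\<ominus>\<^bsub>?M\<^esub> v \<in> ?N" if v: "v \<in> ?N" for v
    proof -
      have "v \<in> carrier ?M" using v \<open>?N \<subseteq> carrier ?M\<close> by blast
      then have "\<ominus>\<^bsub>?M\<^esub> v = (\<ominus>\<^bsub>int_poly_ring\<^esub> 1) \<odot>\<^bsub>?M\<^esub> v"
        using M.smult_l_minus[of 1 v] M.smult_one[of v] by simp
      then show ?thesis using smult[OF v] by simp
    qed
    show "v \<oplus>\<^bsub>?M\<^esub> w \<in> ?N" if "v \<in> ?N" "w \<in> ?N" for v w
      using that unfolding ideal_multiples_of_2_x_def by (auto simp: multiple_of_2_x_add)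
    show "r \<odot>\<^bsub>?M\<^esub> v \<in> ?N" if "v \<in> ?N" for r v using smult[OF that] .
  qed
qed

text \<open>
  This is where coprimality of \<open>2\<close> and \<open>x\<close> enters: cancelling \<open>q\<close> gives \<open>x v\<^sub>1 = 2 v\<^sub>2\<close>, so
  \<open>v\<^sub>2\<close> has constant term \<open>0\<close> and is divisible by \<open>x\<close>.
\<close>

lemma torsion_free_mod_multiples_of_2_x:
  assumes v: "v \<in> carrier (free_mod int_poly_ring 2)" and q: "q \<noteq> 0"
    and qv: "q \<odot>\<^bsub>free_mod int_poly_ring 2\<^esub> v = multiple_of_2_x t"
  obtains s where "v = multiple_of_2_x s"
proof -
  have e1: "q * v 1 = 2 * t" and e2: "q * v 2 = [:0, 1:] * t"
    using fun_cong[OF qv, of 1] fun_cong[OF qv, of 2]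
    by (simp_all add: free_mod_def multiple_of_2_x_def)
  have "q * ([:0, 1:] * v 1) = [:0, 1:] * (q * v 1)" by (simp only: mult.left_commute)
  also have "\<dots> = 2 * ([:0, 1:] * t)" unfolding e1 by (simp only: mult.left_commute)
  also have "\<dots> = q * (2 * v 2)" unfolding e2[symmetric] by (simp only: mult.left_commute)
  finally have cross: "[:0, 1:] * v 1 = 2 * v 2" using q by (simp only: mult_cancel_left simp_thms)
  have "coeff (2 * v 2) 0 = 0" unfolding cross[symmetric] by simp
  then have "coeff (v 2) 0 = 0" by (simp add: coeff_mult_0 numeral_poly)
  then obtain s where s: "v 2 = [:0, 1:] * s"
    by (cases "v 2") (auto intro: that)
  have "[:0, 1:] * v 1 = [:0, 1:] * (2 * s)" unfolding cross s by (simp only: mult.left_commute)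
  then have "v 1 = 2 * s" by (simp only: mult_cancel_left) simp
  with s show thesis using that multiple_of_2_x_eq_iff[OF v] by blast
qed

lemma weakly_semiprime_ideal_multiples_of_2_x:
  "weakly_semiprime_submodule int_poly_ring (free_mod int_poly_ring 2) ideal_multiples_of_2_x"
  unfolding weakly_semiprime_submodule_def
proof (intro conjI ballI impI submodule_ideal_multiples_of_2_x)
  let ?M = "free_mod int_poly_ring 2" and ?N = ideal_multiples_of_2_x
  interpret M: module int_poly_ring ?M using free_mod_module[OF cring_int_poly_ring] .
  fix r m
  assume m: "m \<in> carrier ?M" and "(r [^]\<^bsub>int_poly_ring\<^esub> (2::nat)) \<odot>\<^bsub>?M\<^esub> m \<in> ?N"
  then have r2m: "(r * r) \<odot>\<^bsub>?M\<^esub> m \<in> ?N" by simp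
  show "r \<odot>\<^bsub>?M\<^esub> m \<in> ?N"
  proof (cases "r = 0")
    case True
    then show ?thesis using r2m by simp
  next
    case False
    from r2m obtain t where "(r * r) \<odot>\<^bsub>?M\<^esub> m = multiple_of_2_x t"
      by (auto simp: ideal_multiples_of_2_x_def)
    with m False obtain s where s: "m = multiple_of_2_x s"
      using torsion_free_mod_multiples_of_2_x[of m "r * r" t] by auto
    \<comment> \<open>On constant terms, primality of the ideal \<open>(2, x)\<close> is primality of the integer \<open>2\<close>.\<close>
    from r2m have "even (coeff (r * s) 0)"
      by (auto simp: s multiple_of_2_x_smult multiple_of_2_x_mem_iff coeff_mult_0)
    then show ?thesis by (simp add: s multiple_of_2_x_smult multiple_of_2_x_mem_iff)
  qed
qed

lemma not_semiprime_ideal_multiples_of_2_x: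
  "\<not> semiprime_submodule int_poly_ring 2 ideal_multiples_of_2_x"
proof
  let ?f = "multiple_of_2_x 1"
  assume "semiprime_submodule int_poly_ring 2 ideal_multiples_of_2_x"
  moreover have "?f i \<odot>\<^bsub>free_mod int_poly_ring 2\<^esub> ?f \<in> ideal_multiples_of_2_x"
    if "i \<in> {1..2}" for i
    using that
    by (auto simp: multiple_of_2_x_smult multiple_of_2_x_mem_iff)
      (auto simp: multiple_of_2_x_def numeral_poly)
  ultimately have "?f \<in> ideal_multiples_of_2_x"
    using multiple_of_2_x_closed by (simp add: semiprime_submodule_def)
  then show False by (simp add: multiple_of_2_x_mem_iff)
qed

theorem lemma2:
  shows "(\<forall>(R :: ('a, 'm) ring_scheme) (n :: nat) N.
            cring R \<longrightarrow> n > 0 \<longrightarrow> semiprime_submodule R n N \<longrightarrow>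
            weakly_semiprime_submodule R (free_mod R n) N) \<and>
         (\<exists>(R :: int poly ring) (n :: nat) N.
            cring R \<and> n > 0 \<and> weakly_semiprime_submodule R (free_mod R n) N \<and>
            \<not> semiprime_submodule R n N)"
proof (intro conjI allI impI)
  show "\<exists>(R :: int poly ring) (n :: nat) N.
      cring R \<and> n > 0 \<and> weakly_semiprime_submodule R (free_mod R n) N \<and>
      \<not> semiprime_submodule R n N"
    using cring_int_poly_ring weakly_semiprime_ideal_multiples_of_2_x
      not_semiprime_ideal_multiples_of_2_x zero_less_numeral by blast
qed (rule semiprime_submodule_imp_weakly_semiprime)

end
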